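(* Let $N,n$ be positive integers with $n<N$ and let $b$ be a real non-integer parameter. Then the relation $${}_2F_1\!\left({-n,\,b\atop -N};x\right)=(1-x)^{-N+n-b}\,{}_2F_1\!\left({n-N,\,-N-b\atop -N};x\right)$$ holds up to terms of degree $N$ in $x$; that is, the power series expansions of both sides at $x=0$ have the same coefficients of $x^k$ for all $0\le k\le N$.
   Context: $(a)_k=a(a+1)\cdots(a+k-1)$. For an integer $0\le n\le N$, ${}_2F_1(-n,c;-N;x)$ denotes the polynomial $\sum_{k=0}^{n}\frac{(-n)_k(c)_k}{(-N)_k\,k!}x^k$ (so ${}_2F_1(n-N,c;-N;x)$ is the analogous sum over $0\le k\le N-n$). $(1-x)^\beta=\sum_{s\ge0}\frac{(-\beta)_s}{s!}x^s$. *)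

theory Defs
  imports Complex_Main "HOL-Computational_Algebra.Computational_Algebra"
begin

text \<open>
  The terminating series \<open>\<^sub>2F\<^sub>1(-m, c; -N; x)\<close> with \<open>m \<le> N\<close>, truncated at \<open>k = m\<close>: the upper
  parameter \<open>-m\<close> and the lower parameter \<open>-N\<close> are passed as the natural numbers \<open>m\<close> and \<open>N\<close>.
  For \<open>k \<le> m \<le> N\<close> the denominator \<open>(-N)\<^sub>k\<close> does not vanish.
\<close>

definition hyp2F1_poly :: "nat \<Rightarrow> real \<Rightarrow> nat \<Rightarrow> real poly" where
  "hyp2F1_poly m c N =
     (\<Sum>k\<le>m. monom (pochhammer (- real m) k * pochhammer c k /
                     (pochhammer (- real N) k * fact k)) k)"

definition fps_one_minus_powr :: "real \<Rightarrow> real fps" where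
  "fps_one_minus_powr \<beta> = Abs_fps (\<lambda>s. pochhammer (- \<beta>) s / fact s)"

lemma fps_one_minus_powr_eq_binomial:
  "fps_one_minus_powr \<beta> = fps_compose (fps_binomial \<beta>) (- fps_X)"
  by (simp add: fps_one_minus_powr_def fps_eq_iff fps_compose_uminus'
        gbinomial_pochhammer fps_binomial_nth mult.assoc [symmetric] power_mult_distrib [symmetric])

end

theory Submission
  imports Defs
begin

text \<open>
  The relation is Euler's transformation \<open>\<^sub>2F\<^sub>1(a,b;c;x) = (1-x)\<^bsup>c-a-b\<^esup> \<^sub>2F\<^sub>1(c-a,c-b;c;x)\<close> at
  \<open>a = -n\<close>, \<open>c = -N\<close>, compared coefficientwise as long as \<open>(c)\<^sub>k \<noteq> 0\<close>, that is for \<open>k \<le> N\<close>.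
  Multiplying the coefficients of \<open>x\<^sup>k\<close> by \<open>(c)\<^sub>k k!\<close> yields a form of the Pfaff--Saalschuetz
  identity without denominators, valid for all parameters. With \<open>S k c\<close> denoting its left-hand
  side, Pascal's rule gives
  \<open>S (k+1) c = ((c-u)(c-v) + k(c+k)) S k c + k (c-u-v) (c-u)(c-v) S (k-1) (c+1)\<close>,
  from which the closed form follows by induction on \<open>k\<close>.
\<close>

lemma sum_binomial_Suc:
  fixes f :: "nat \<Rightarrow> 'a::comm_semiring_1"
  shows "(\<Sum>j\<le>Suc k. of_nat (Suc k choose j) * f j) =
         (\<Sum>j\<le>k. of_nat (k choose j) * (f j + f (Suc j)))"
proof -
  have "(\<Sum>j\<le>Suc k. of_nat (Suc k choose j) * f j) =
        f 0 + (\<Sum>j\<le>k. of_nat (k choose Suc j) * f (Suc j))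
            + (\<Sum>j\<le>k. of_nat (k choose j) * f (Suc j))"
    by (subst sum.atMost_Suc_shift) (simp add: algebra_simps sum.distrib)
  also have "f 0 + (\<Sum>j\<le>k. of_nat (k choose Suc j) * f (Suc j)) =
             (\<Sum>j\<le>Suc k. of_nat (k choose j) * f j)"
    by (subst sum.atMost_Suc_shift) simp
  also have "\<dots> = (\<Sum>j\<le>k. of_nat (k choose j) * f j)"
    by (simp add: binomial_eq_0)
  finally show ?thesis
    by (simp add: algebra_simps sum.distrib)
qed

text \<open>Both products of length \<open>Suc m\<close> share the factor
  \<open>pochhammer (c + 1) m\<close>, and the remaining factors \<open>c + 1 + m\<close> and
  \<open>c\<close> differ by \<open>m + 1\<close>. This difference turns \<open>T\<close> into
  \<open>S\<close> below.\<close>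

lemma pochhammer_Suc_shift_diff:
  fixes c :: "'a::comm_ring_1"
  shows "pochhammer (c + 1) (Suc m) = pochhammer c (Suc m) + of_nat (Suc m) * pochhammer (c + 1) m"
  unfolding pochhammer_rec[of c] pochhammer_Suc[of "c + 1"] by (simp add: algebra_simps)

text \<open>Absorption, \<open>(m + 1 - j) * (m + 1 choose j) = (m + 1) * (m choose j)\<close>; the
  top term \<open>j = Suc m\<close> vanishes.\<close>

lemma sum_binomial_Suc_diff:
  fixes f :: "nat \<Rightarrow> 'a::comm_semiring_1"
  shows "(\<Sum>j\<le>Suc m. of_nat (Suc m choose j) * (of_nat (Suc m - j) * f j)) =
         of_nat (Suc m) * (\<Sum>j\<le>m. of_nat (m choose j) * f j)"
proof -
  have "of_nat (Suc m choose j) * (of_nat (Suc m - j) * f j) =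
        of_nat (Suc m) * (of_nat (m choose j) * f j)" if "j \<le> m" for j
  proof -
    have "(Suc m - j) * (Suc m choose j) = Suc m * (m choose j)"
      using binomial_absorb_comp[of "Suc m" j] by simp
    then have "of_nat (Suc m - j) * (of_nat (Suc m choose j) :: 'a) =
               of_nat (Suc m) * of_nat (m choose j)"
      by (metis of_nat_mult)
    then show ?thesis
      by (metis mult.assoc mult.commute)
  qed
  then show ?thesis
    by (simp add: sum_distrib_left del: of_nat_Suc)
qed

text \<open>Dividing by \<open>pochhammer c k * pochhammer (c - u - v) k\<close>, where possible,
  gives the usual sum of the balanced series
  \<open>3F2(-k, u, v; c, 1 - c + u + v - k; 1)\<close>.\<close>

lemma Saalschuetz_pochhammer:
  fixes u v c :: "'a::comm_ring_1"
  shows "(\<Sum>j\<le>k. of_nat (k choose j) * (pochhammer (c - u - v) (k - j) * pochhammer u j *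
            pochhammer v j * pochhammer (c + of_nat j) (k - j))) =
         pochhammer (c - u) k * pochhammer (c - v) k"
proof -
  define S where "S k c = (\<Sum>j\<le>k. of_nat (k choose j) * (pochhammer (c - u - v) (k - j) *
      pochhammer u j * pochhammer v j * pochhammer (c + of_nat j) (k - j)))" for k and c :: 'a
  \<comment> \<open>Only the last factor is shifted, while \<open>c - u - v\<close> is kept, so
    \<open>T k c\<close> is not \<open>S k (c + 1)\<close>.\<close>
  define T where "T k c = (\<Sum>j\<le>k. of_nat (k choose j) * (pochhammer (c - u - v) (k - j) *
      pochhammer u j * pochhammer v j * pochhammer (c + 1 + of_nat j) (k - j)))" for k and c :: 'a
  have rec: "S (Suc k) c = (c - u) * (c - v) * T k c + of_nat k * (c + of_nat k) * S k c" for k c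
  proof -
    have "S (Suc k) c = (\<Sum>j\<le>k. of_nat (k choose j) *
        (pochhammer (c - u - v) (Suc k - j) * pochhammer u j * pochhammer v j *
           pochhammer (c + of_nat j) (Suc k - j) +
         pochhammer (c - u - v) (Suc k - Suc j) * pochhammer u (Suc j) * pochhammer v (Suc j) *
           pochhammer (c + of_nat (Suc j)) (Suc k - Suc j)))"
      unfolding S_def by (rule sum_binomial_Suc)
    also have "\<dots> = (\<Sum>j\<le>k. of_nat (k choose j) *
        ((c - u) * (c - v) * (pochhammer (c - u - v) (k - j) * pochhammer u j * pochhammer v j *
             pochhammer (c + 1 + of_nat j) (k - j)) +
         of_nat k * (c + of_nat k) * (pochhammer (c - u - v) (k - j) * pochhammer u j *
             pochhammer v j * pochhammer (c + of_nat j) (k - j))))"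
    proof (intro sum.cong refl arg_cong2[where f = "(*)"])
      fix j assume "j \<in> {..k}"
      then obtain m where k: "k = j + m"
        by (auto simp: le_iff_add)
      define J M :: 'a where "J = of_nat j" "M = of_nat m"
      define W U V where "W = pochhammer (c - u - v) m" "U = pochhammer u j" "V = pochhammer v j"
      define P Q where "P = pochhammer (c + 1 + J) m" "Q = pochhammer (c + J) m"
      have Suc_m: "pochhammer (c + J) (Suc m) = (c + J) * P"
        by (simp add: P_Q_def pochhammer_rec add_ac)
      \<comment> \<open>Splitting off the first or the last factor of the same product; this trades
        \<open>P\<close> for \<open>Q\<close>, which occurs in \<open>S\<close>.\<close>
      have swap: "(c + J) * P = Q * (c + J + M)"
        unfolding Suc_m[symmetric] pochhammer_Suc P_Q_def(2) J_M_def(2) ..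
      have Suc_j: "c + of_nat (Suc j) = c + 1 + J"
        by (simp add: J_M_def add_ac)
      have diffs: "k - j = m" "Suc k - j = Suc m" "Suc k - Suc j = m"
        using k by auto
      \<comment> \<open>Up to the common factor \<open>W * U * V * P\<close> this is
        \<open>(c-u-v+M)(c+J) + (u+J)(v+J) = (c-u)(c-v) + (J+M)(c+J)\<close>.\<close>
      have "W * (c - u - v + M) * U * V * ((c + J) * P) + U * (u + J) * (V * (v + J)) * W * P =
            W * U * V * ((c - u) * (c - v) * P + (J + M) * ((c + J) * P))"
        by (simp add: algebra_simps)
      then have "W * (c - u - v + M) * U * V * ((c + J) * P) +
              W * (U * (u + J)) * (V * (v + J)) * P =
            (c - u) * (c - v) * (W * U * V * P) + (J + M) * (c + (J + M)) * (W * U * V * Q)"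
        unfolding swap by (simp add: algebra_simps)
      then show "pochhammer (c - u - v) (Suc k - j) * pochhammer u j * pochhammer v j *
           pochhammer (c + of_nat j) (Suc k - j) +
         pochhammer (c - u - v) (Suc k - Suc j) * pochhammer u (Suc j) * pochhammer v (Suc j) *
           pochhammer (c + of_nat (Suc j)) (Suc k - Suc j) =
         (c - u) * (c - v) * (pochhammer (c - u - v) (k - j) * pochhammer u j * pochhammer v j *
             pochhammer (c + 1 + of_nat j) (k - j)) +
         of_nat k * (c + of_nat k) * (pochhammer (c - u - v) (k - j) * pochhammer u j *
             pochhammer v j * pochhammer (c + of_nat j) (k - j))"
        unfolding diffs Suc_j J_M_def(1)[symmetric] Suc_m
        unfolding pochhammer_Suc k of_nat_add P_Q_def[symmetric] W_U_V_def[symmetric]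
          J_M_def[symmetric] .
    qed
    also have "\<dots> = (c - u) * (c - v) * T k c + of_nat k * (c + of_nat k) * S k c"
      unfolding S_def T_def sum_distrib_left sum.distrib[symmetric]
      by (rule sum.cong) (simp_all only: distrib_left mult.left_commute)
    finally show ?thesis .
  qed
  have T_Suc: "T (Suc m) c = S (Suc m) c + of_nat (Suc m) * (c - u - v) * S m (c + 1)" for m c
  proof -
    \<comment> \<open>At \<open>j = Suc m\<close> the truncated \<open>m - j\<close> is harmless,
      since \<open>g j\<close> is always weighted by \<open>Suc m - j\<close>.\<close>
    define g where "g j = pochhammer (c - u - v) (Suc m - j) * pochhammer u j * pochhammer v j *
       pochhammer (c + 1 + of_nat j) (m - j)" for j
    have "pochhammer (c + 1 + of_nat j) (Suc m - j) =
        pochhammer (c + of_nat j) (Suc m - j) +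
        of_nat (Suc m - j) * pochhammer (c + 1 + of_nat j) (m - j)" if "j \<le> Suc m" for j
    proof (cases "j = Suc m")
      case False
      then have "Suc m - j = Suc (m - j)" using that by auto
      then show ?thesis
        using pochhammer_Suc_shift_diff[of "c + of_nat j" "m - j"] by (simp add: add_ac)
    qed simp
    then have "T (Suc m) c = S (Suc m) c +
        (\<Sum>j\<le>Suc m. of_nat (Suc m choose j) * (of_nat (Suc m - j) * g j))"
      unfolding T_def S_def g_def sum.distrib[symmetric]
      by (intro sum.cong refl) (simp only: atMost_iff distrib_left mult_ac)
    also have "(\<Sum>j\<le>Suc m. of_nat (Suc m choose j) * (of_nat (Suc m - j) * g j)) =
        of_nat (Suc m) * (\<Sum>j\<le>m. of_nat (m choose j) * g j)"
      by (rule sum_binomial_Suc_diff)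
    also have "(\<Sum>j\<le>m. of_nat (m choose j) * g j) = (c - u - v) * S m (c + 1)"
      unfolding S_def sum_distrib_left
    proof (rule sum.cong)
      fix j assume "j \<in> {..m}"
      \<comment> \<open>Peeling off the first factor shifts \<open>c\<close> here as well, so that
        \<open>S m (c + 1)\<close> appears.\<close>
      then have "pochhammer (c - u - v) (Suc m - j) =
          (c - u - v) * pochhammer (c + 1 - u - v) (m - j)"
        by (simp add: Suc_diff_le pochhammer_rec algebra_simps)
      then show "of_nat (m choose j) * g j = (c - u - v) * (of_nat (m choose j) *
          (pochhammer (c + 1 - u - v) (m - j) * pochhammer u j * pochhammer v j *
           pochhammer (c + 1 + of_nat j) (m - j)))"
        by (simp only: g_def mult_ac)
    qed simp
    finally show ?thesis
      by (simp only: mult.assoc)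
  qed
  have "S k c = pochhammer (c - u) k * pochhammer (c - v) k" for k c
  proof (induction k arbitrary: c rule: less_induct)
    case (less k)
    consider "k = 0" | "k = 1" | m where "k = Suc (Suc m)"
      by (metis One_nat_def not0_implies_Suc)
    then show ?case
    proof cases
      case 1
      then show ?thesis by (simp add: S_def)
    next
      case 2
      then show ?thesis
        using rec[of 0 c] by (simp add: T_def)
    next
      case 3
      \<comment> \<open>By induction both sides have closed forms. This makes
        \<open>S (Suc m) c\<close> a common factor of all terms of the recurrence.\<close>
      have eq: "S (Suc m) c = (c - u) * (c - v) * S m (c + 1)"
        using less.IH[of "Suc m" c] less.IH[of m "c + 1"] 3
        by (simp add: pochhammer_rec algebra_simps)
      define M :: 'a where "M = of_nat (Suc m)"
      have "S k c = (c - u) * (c - v) * (S (Suc m) c + M * (c - u - v) * S m (c + 1)) +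
              M * (c + M) * S (Suc m) c"
        unfolding 3 rec T_Suc M_def ..
      also have "\<dots> = (c - u) * (c - v) * S (Suc m) c +
              M * (c - u - v) * ((c - u) * (c - v) * S m (c + 1)) + M * (c + M) * S (Suc m) c"
        by (simp add: algebra_simps)
      also have "\<dots> = (c - u + M) * (c - v + M) * S (Suc m) c"
        unfolding eq[symmetric] by (simp add: algebra_simps)
      also have "S (Suc m) c = pochhammer (c - u) (Suc m) * pochhammer (c - v) (Suc m)"
        using less.IH 3 by simp
      finally show ?thesis
        unfolding 3 M_def pochhammer_Suc[of _ "Suc m"] by (simp only: mult_ac)
    qed
  qed
  then show ?thesis
    by (simp add: S_def)
qed

text \<open>The previous identity with \<open>u = c - a\<close> and \<open>v = c - b\<close>,
  divided by \<open>pochhammer c k * fact k\<close>. For \<open>j \<le> k\<close> the factor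
  \<open>pochhammer c j\<close> divides \<open>pochhammer c k\<close>, so it is nonzero too.\<close>

lemma Euler_transformation_coeff:
  fixes a b c :: "'a::field_char_0"
  assumes "pochhammer c k \<noteq> 0"
  shows "pochhammer a k * pochhammer b k / (pochhammer c k * fact k) =
         (\<Sum>j\<le>k. pochhammer (a + b - c) (k - j) / fact (k - j) *
            (pochhammer (c - a) j * pochhammer (c - b) j / (pochhammer c j * fact j)))"
proof -
  have "pochhammer a k * pochhammer b k =
      (\<Sum>j\<le>k. of_nat (k choose j) * (pochhammer (a + b - c) (k - j) * pochhammer (c - a) j *
          pochhammer (c - b) j * pochhammer (c + of_nat j) (k - j)))"
    using Saalschuetz_pochhammer[of k c "c - a" "c - b"] by (simp add: algebra_simps)
  also have "\<dots> = (\<Sum>j\<le>k. pochhammer c k * fact k * (pochhammer (a + b - c) (k - j) / fact (k - j) *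
            (pochhammer (c - a) j * pochhammer (c - b) j / (pochhammer c j * fact j))))"
  proof (rule sum.cong)
    fix j assume "j \<in> {..k}"
    then have j: "j \<le> k" by simp
    have split: "pochhammer c k = pochhammer c j * pochhammer (c + of_nat j) (k - j)"
      using j by (rule pochhammer_product)
    with assms have "pochhammer c j \<noteq> 0" by auto
    then show "of_nat (k choose j) * (pochhammer (a + b - c) (k - j) * pochhammer (c - a) j *
          pochhammer (c - b) j * pochhammer (c + of_nat j) (k - j)) =
        pochhammer c k * fact k * (pochhammer (a + b - c) (k - j) / fact (k - j) *
            (pochhammer (c - a) j * pochhammer (c - b) j / (pochhammer c j * fact j)))"
      unfolding split binomial_fact[OF j] by (simp add: field_simps)
  qed simp
  finally show ?thesis
    unfolding sum_distrib_left[symmetric] using assms by (simp del: times_divide_eq_right)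
qed

text \<open>No bound on \<open>k\<close> is needed: for \<open>k > m\<close> the factor
  \<open>pochhammer (- real m) k\<close> is zero.\<close>

lemma coeff_hyp2F1_poly:
  "coeff (hyp2F1_poly m c N) k =
     pochhammer (- real m) k * pochhammer c k / (pochhammer (- real N) k * fact k)"
  by (cases "k \<le> m")
     (auto simp: hyp2F1_poly_def coeff_sum coeff_monom pochhammer_of_nat_eq_0_lemma)

theorem propositionB1:
  fixes N n :: nat and b :: real
  assumes "0 < n" and "n < N" and "b \<notin> \<int>"
  shows "\<forall>k\<le>N. fps_nth (fps_of_poly (hyp2F1_poly n b N)) k =
           fps_nth (fps_one_minus_powr (- real N + real n - b) *
                    fps_of_poly (hyp2F1_poly (N - n) (- real N - b) N)) k"
proof (intro allI impI)
  fix k assume "k \<le> N"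
  \<comment> \<open>This is where the comparison is confined to degrees up to
    \<open>N\<close>.\<close>
  then have "pochhammer (- real N) k \<noteq> 0"
    by (simp add: pochhammer_of_nat_eq_0_iff)
  \<comment> \<open>Here \<open>a + b - c = N - n + b\<close> is the negated exponent of
    \<open>1 - x\<close>, and \<open>c - a = -(N - n)\<close> is again a terminating
    parameter.\<close>
  from Euler_transformation_coeff[OF this, of "- real n" b]
  have "fps_nth (fps_of_poly (hyp2F1_poly n b N)) k =
      (\<Sum>j\<le>k. fps_nth (fps_of_poly (hyp2F1_poly (N - n) (- real N - b) N)) j *
              fps_nth (fps_one_minus_powr (- real N + real n - b)) (k - j))"
    using \<open>n < N\<close>
    by (simp add: coeff_hyp2F1_poly fps_one_minus_powr_def of_nat_diff algebra_simps)
  also have "\<dots> = fps_nth (fps_of_poly (hyp2F1_poly (N - n) (- real N - b) N) *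
                    fps_one_minus_powr (- real N + real n - b)) k"
    by (simp only: fps_mult_nth atLeast0AtMost)
  finally show "fps_nth (fps_of_poly (hyp2F1_poly n b N)) k =
           fps_nth (fps_one_minus_powr (- real N + real n - b) *
                    fps_of_poly (hyp2F1_poly (N - n) (- real N - b) N)) k"
    by (simp only: mult.commute)
qed

end
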